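(* Let $A\in\mathbb{C}^{n\times n}$ and $r_0\in\mathbb{C}^n$, and let $V_j$, $V_{j+1}$, $\overline H_j$ be the matrices produced by $j$ steps of the Arnoldi process for $A$ with starting vector $r_0$. Let $\mathcal{U}\subseteq\mathbb{C}^n$ be a $k$-dimensional subspace and $U\in\mathbb{C}^{n\times k}$ a matrix whose columns form a basis of $\mathcal{U}$ and such that $C:=AU$ has orthonormal columns. For the choices of subspaces $\mathcal{V}_j=\mathcal{K}_j(A,r_0)$, $\widetilde{\mathcal{V}}_j=A\mathcal{V}_j$ and $\widetilde{\mathcal{U}}=A\,\mathcal{U}$ (with basis matrices $\widetilde V_j=AV_j$ and $\widetilde U=C$), the linear system $$\bigl(\widetilde V_j^*(I-\Phi)AV_j\bigr)y_j=\widetilde V_j^*(I-\Phi)r_0,\qquad \Phi:=AU(\widetilde U^*AU)^{-1}\widetilde U^*,$$ for $y_j\in\mathbb{C}^j$ reduces to the $j\times j$ linear system $$\bigl(\overline H_j^*\overline H_j-\overline H_j^*V_{j+1}^*CC^*V_{j+1}\overline H_j\bigr)y_j=\overline H_j^*V_{j+1}^*(I-CC^* )r_0 .$$ The coefficient vector $z_j:=(\widetilde U^*AU)^{-1}\widetilde U^*r_0-(\widetilde U^*AU)^{-1}(\widetilde U^*AV_j)y_j\in\mathbb{C}^k$ is then $$z_j=C^*r_0-B_jy_j,$$ where $B_j:=(\widetilde U^*AU)^{-1}\widetilde U^*AV_j$.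
   Context: $I$ is the $n\times n$ identity and ${}^*$ denotes conjugate transpose. $\mathcal{K}_j(A,r_0)=\operatorname{span}\{r_0,Ar_0,\dots,A^{j-1}r_0\}$. Arnoldi process: it is assumed to run $j$ steps without breakdown, producing $V_{j+1}=[v_1,\dots,v_{j+1}]\in\mathbb{C}^{n\times(j+1)}$ with orthonormal columns, whose first $j$ columns form $V_j\in\mathbb{C}^{n\times j}$ with range $\mathcal{K}_j(A,r_0)$, and an upper Hessenberg matrix $\overline H_j\in\mathbb{C}^{(j+1)\times j}$, such that $AV_j=V_{j+1}\overline H_j$. Setting: an augmented method approximates the solution of $Ax=b$ by $x_j=x_0+Uz_j+V_jy_j$, where $r_0=b-Ax_0$, with residual orthogonal to $\widetilde{\mathcal{U}}+\widetilde{\mathcal{V}}_j$, where $\widetilde{\mathcal{U}}$ and $\widetilde{\mathcal{V}}_j$ have bases given by the columns of $\widetilde U$ and $\widetilde V_j$; the displayed system for $y_j$ and formula for $z_j$ are the general equations determining these coefficients. "Reduces to" means that, for the stated choices, the coefficient matrices and right-hand sides of the two systems coincide. *)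

theory Defs
  imports "Jordan_Normal_Form.Schur_Decomposition"
    "Jordan_Normal_Form.Gauss_Jordan_Elimination"
begin

text \<open>Subspaces of $\mathbb{C}^n$ are sets of vectors. The conjugate transpose is
  \<open>mat_adjoint\<close>, and \<open>x \<bullet>c y\<close> is the inner product that conjugates \<open>y\<close>.\<close>

abbreviation complex_space :: "nat \<Rightarrow> (complex, complex vec) module" where
  "complex_space n \<equiv> module_vec TYPE(complex) n"

abbreviation complex_span :: "nat \<Rightarrow> complex vec set \<Rightarrow> complex vec set" where
  "complex_span n \<equiv> LinearCombinations.module.span class_ring (complex_space n)"

abbreviation complex_subspace :: "nat \<Rightarrow> complex vec set \<Rightarrow> bool" where
  "complex_subspace n W \<equiv> VectorSpace.subspace class_ring W (complex_space n)"

text \<open>The dimension of \<open>W\<close> and the bases of \<open>W\<close> are those of the vector space whose carrier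
  is \<open>W\<close>, with the operations of $\mathbb{C}^n$.\<close>

abbreviation subspace_dim :: "nat \<Rightarrow> complex vec set \<Rightarrow> nat" where
  "subspace_dim n W \<equiv> vectorspace.dim class_ring ((complex_space n)\<lparr>carrier := W\<rparr>)"

text \<open>\<open>basis\<close> only sees the set of columns; distinctness excludes repeated columns.\<close>

definition basis_matrix :: "nat \<Rightarrow> nat \<Rightarrow> complex mat \<Rightarrow> complex vec set \<Rightarrow> bool" where
  "basis_matrix n k M W \<longleftrightarrow>
     M \<in> carrier_mat n k \<and> complex_subspace n W \<and> distinct (cols M) \<and>
     vectorspace.basis class_ring ((complex_space n)\<lparr>carrier := W\<rparr>) (set (cols M))"

definition orthonormal_cols :: "complex mat \<Rightarrow> bool" where
  "orthonormal_cols M \<longleftrightarrow>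
     (\<forall>i < dim_col M. \<forall>l < dim_col M. col M i \<bullet>c col M l = (if i = l then 1 else 0))"

definition upper_hessenberg :: "complex mat \<Rightarrow> bool" where
  "upper_hessenberg H \<longleftrightarrow>
     (\<forall>i < dim_row H. \<forall>l < dim_col H. l + 1 < i \<longrightarrow> H $$ (i, l) = 0)"

definition first_cols :: "nat \<Rightarrow> complex mat \<Rightarrow> complex mat" where
  "first_cols j M = mat_of_cols (dim_row M) (take j (cols M))"

definition krylov :: "nat \<Rightarrow> complex mat \<Rightarrow> complex vec \<Rightarrow> nat \<Rightarrow> complex vec set" where
  "krylov n A r j = complex_span n {(A ^\<^sub>m i) *\<^sub>v r | i. i < j}"

text \<open>The output of \<open>j\<close> Arnoldi steps without breakdown for the $n\times n$ matrix \<open>A\<close> with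
  starting vector \<open>r\<close>: \<open>V\<close> is $V_{j+1}$, its first \<open>j\<close> columns are $V_j$, and \<open>H\<close> is the
  $(j+1)\times j$ matrix $\overline H_j$.\<close>

definition arnoldi ::
  "nat \<Rightarrow> complex mat \<Rightarrow> complex vec \<Rightarrow> nat \<Rightarrow> complex mat \<Rightarrow> complex mat \<Rightarrow> bool" where
  "arnoldi n A r j V H \<longleftrightarrow>
     V \<in> carrier_mat n (j + 1) \<and> orthonormal_cols V \<and>
     vec_space.col_space n (first_cols j V) = krylov n A r j \<and>
     H \<in> carrier_mat (j + 1) j \<and> upper_hessenberg H \<and>
     A * first_cols j V = V * H"

text \<open>The general augmented method with approximations $x_0 + Uz + Vy$ and residual orthogonal
  to the columns of \<open>Ut\<close> and \<open>Vt\<close>: \<open>y\<close> solves the system with coefficient matrix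
  \<open>aug_matrix\<close> and right-hand side \<open>aug_rhs\<close>, and \<open>z\<close> is \<open>aug_z\<close> at \<open>y\<close>. The library's \<open>mat_inverse\<close> is option-valued; \<open>mat_inv\<close> is
  meaningful for invertible matrices only.\<close>

definition mat_inv :: "complex mat \<Rightarrow> complex mat" where
  "mat_inv M = the (mat_inverse M)"

definition aug_Phi :: "complex mat \<Rightarrow> complex mat \<Rightarrow> complex mat \<Rightarrow> complex mat" where
  "aug_Phi A U Ut =
     A * U * mat_inv (mat_adjoint Ut * A * U) * mat_adjoint Ut"

definition aug_matrix ::
  "complex mat \<Rightarrow> complex mat \<Rightarrow> complex mat \<Rightarrow> complex mat \<Rightarrow> complex mat \<Rightarrow> complex mat" where
  "aug_matrix A U V Ut Vt =
     mat_adjoint Vt * (1\<^sub>m (dim_row A) - aug_Phi A U Ut) * A * V"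

definition aug_rhs ::
  "complex mat \<Rightarrow> complex vec \<Rightarrow> complex mat \<Rightarrow> complex mat \<Rightarrow> complex mat \<Rightarrow> complex vec" where
  "aug_rhs A r U Ut Vt =
     (mat_adjoint Vt * (1\<^sub>m (dim_row A) - aug_Phi A U Ut)) *\<^sub>v r"

definition aug_z ::
  "complex mat \<Rightarrow> complex vec \<Rightarrow> complex mat \<Rightarrow> complex mat \<Rightarrow> complex mat \<Rightarrow> complex vec
     \<Rightarrow> complex vec" where
  "aug_z A r U V Ut y =
     (mat_inv (mat_adjoint Ut * A * U) * mat_adjoint Ut) *\<^sub>v r
     - (mat_inv (mat_adjoint Ut * A * U) * (mat_adjoint Ut * A * V)) *\<^sub>v y"

end

theory Submission
  imports Defs "Jordan_Normal_Form.DL_Rank"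
begin

text \<open>
  Everything rests on three identities. Orthonormality of the columns of \<open>C = AU\<close> says
  \<open>C\<^sup>* C = I\<close>; since the test basis for \<open>A\<U>\<close> is \<open>C\<close> itself, the small matrix that the general
  method inverts is this Gram matrix, so its inverse disappears and \<open>\<Phi>\<close> becomes the orthogonal
  projection \<open>C C\<^sup>*\<close>. The Arnoldi relation turns \<open>A V\<^sub>j\<close> into \<open>V H\<close>, hence the test matrix into
  \<open>H\<^sup>* V\<^sup>*\<close> after conjugate transposition. Finally \<open>V\<^sup>* V = I\<close> collapses the unprojected part
  \<open>H\<^sup>* V\<^sup>* V H\<close> of the coefficient matrix to \<open>H\<^sup>* H\<close>. The first identity also yields
  the formula for \<open>z\<close>.

  For the claims that the chosen matrices are bases, a basis matrix of \<open>W\<close> is viewed as an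
  injective linear map from $\mathbb{C}^k$ with image \<open>W\<close> (\<open>basis_matrix_iff_inj_image\<close>).
  Applying \<open>A\<close> to a subspace is then composition of maps, and injectivity
  comes from a left inverse, namely the conjugate transpose of a matrix with
  orthonormal columns, and for \<open>A V\<^sub>j\<close> from the injectivity of \<open>A\<close> on the Krylov space.
\<close>

section \<open>Basis matrices as injective linear maps\<close>

text \<open>
  The column span is the image, and a linear dependence among distinct columns is a nonzero
  kernel vector. Distinctness is itself part of injectivity, because the columns are the images
  of the unit vectors. The vector space with carrier \<open>W\<close> has the same spans and dependences as
  the ambient space once \<open>W\<close> is known to be a subspace containing the columns.
\<close>

lemma basis_matrix_iff_inj_image:
  "basis_matrix n k M W \<longleftrightarrow>
     M \<in> carrier_mat n k \<and> W = (*\<^sub>v) M ` carrier_vec k \<and> inj_on ((*\<^sub>v) M) (carrier_vec k)"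
proof (cases "M \<in> carrier_mat n k")
  case False
  then show ?thesis by (simp add: basis_matrix_def)
next
  case M: True
  interpret vec_space "TYPE(complex)" n .
  have cols: "set (cols M) \<subseteq> carrier_vec n"
    using M cols_dim by blast
  have image: "(*\<^sub>v) M ` carrier_vec k = span (set (cols M))"
    using col_space_eq[OF M] M by (auto simp: col_space_def)
  have basis: "complex_subspace n W \<and>
      vectorspace.basis class_ring ((complex_space n)\<lparr>carrier := W\<rparr>) (set (cols M)) \<longleftrightarrow>
      W = span (set (cols M)) \<and> lin_indpt (set (cols M))" (is "?L \<longleftrightarrow> ?R")
  proof
    assume L: ?L
    then have sub: "submodule class_ring W V" and vs: "vectorspace class_ring (vs W)"
      using subspace_is_vs by (auto simp: subspace_def)
    have W: "set (cols M) \<subseteq> W"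
      using L vectorspace.basis_def[OF vs] by auto
    show ?R
      using L vectorspace.basis_def[OF vs] span_li_not_depend[OF W sub] by auto
  next
    assume R: ?R
    then have sub: "submodule class_ring W V"
      using span_is_submodule cols by auto
    then have subspace: "complex_subspace n W"
      using vectorspace_axioms by (intro subspace.intro)
    then have vs: "vectorspace class_ring (vs W)"
      by (rule subspace_is_vs)
    have W: "set (cols M) \<subseteq> W"
      using R in_own_span cols by auto
    show ?L
      using R subspace vectorspace.basis_def[OF vs] span_li_not_depend[OF W sub] W by auto
  qed
  have indep: "distinct (cols M) \<and> lin_indpt (set (cols M)) \<longleftrightarrow>
      inj_on ((*\<^sub>v) M) (carrier_vec k)"
  proof
    assume L: "distinct (cols M) \<and> lin_indpt (set (cols M))"
    show "inj_on ((*\<^sub>v) M) (carrier_vec k)"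
    proof (rule inj_onI)
      fix x y :: "complex vec"
      assume x: "x \<in> carrier_vec k" and y: "y \<in> carrier_vec k" and eq: "M *\<^sub>v x = M *\<^sub>v y"
      have "M *\<^sub>v (x - y) = M *\<^sub>v x - M *\<^sub>v y"
        using M x y by (simp add: mult_minus_distrib_mat_vec)
      also have "\<dots> = 0\<^sub>v n"
        using M y eq by auto
      finally have "x - y = 0\<^sub>v k"
        using lin_depI[OF M, of "x - y"] L x y by auto
      then show "x = y"
        using x y by (auto simp: vec_eq_iff)
    qed
  next
    assume inj: "inj_on ((*\<^sub>v) M) (carrier_vec k)"
    have "distinct (cols M)"
      unfolding distinct_conv_nth
    proof (intro allI impI)
      fix i l
      assume i: "i < length (cols M)" and l: "l < length (cols M)" and "i \<noteq> l"
      then have "unit_vec k i \<noteq> (unit_vec k l :: complex vec)"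
        using M by (simp)
      then have "M *\<^sub>v unit_vec k i \<noteq> M *\<^sub>v unit_vec k l"
        using inj by (meson inj_onD unit_vec_carrier)
      moreover have "M *\<^sub>v unit_vec k p = cols M ! p" if "p < length (cols M)" for p
        using M that by (intro eq_vecI) auto
      ultimately show "cols M ! i \<noteq> cols M ! l"
        using i l by simp
    qed
    moreover have "lin_indpt (set (cols M))"
    proof
      assume "lin_dep (set (cols M))"
      then obtain v where v: "v \<in> carrier_vec k" "v \<noteq> 0\<^sub>v k" "M *\<^sub>v v = 0\<^sub>v n"
        using lin_depE[OF M] \<open>distinct (cols M)\<close> by blast
      moreover have "M *\<^sub>v 0\<^sub>v k = 0\<^sub>v n"
        using M by auto
      ultimately show False
        using inj_onD[OF inj, of v "0\<^sub>v k"] by simp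
    qed
    ultimately show "distinct (cols M) \<and> lin_indpt (set (cols M))" ..
  qed
  show ?thesis
    unfolding basis_matrix_def image using M basis indep by auto
qed

section \<open>Conjugate transposes and orthonormal columns\<close>

lemma inj_on_if_left_inverse:
  fixes L M :: "complex mat"
  assumes "L \<in> carrier_mat k n" and "M \<in> carrier_mat n k" and "L * M = 1\<^sub>m k"
  shows "inj_on ((*\<^sub>v) M) (carrier_vec k)"
proof (rule inj_on_inverseI)
  fix x :: "complex vec" assume x: "x \<in> carrier_vec k"
  then show "L *\<^sub>v (M *\<^sub>v x) = x"
    using assoc_mult_mat_vec[OF assms(1,2) x] assms(3) by simp
qed

lemma mat_adjoint_dim [simp]:
  "dim_row (mat_adjoint M) = dim_col M" "dim_col (mat_adjoint M) = dim_row M"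
  by (simp_all add: mat_adjoint_def)

lemma mat_adjoint_carrier [simp]:
  "M \<in> carrier_mat n k \<Longrightarrow> mat_adjoint M \<in> carrier_mat k n"
  by (intro carrier_matI) simp_all

lemma mat_adjoint_index [simp]:
  "i < dim_col M \<Longrightarrow> l < dim_row M \<Longrightarrow> mat_adjoint M $$ (i, l) = conjugate (M $$ (l, i))"
  by (simp add: mat_adjoint_def mat_of_rows_index)

lemma mat_adjoint_mult:
  fixes M N :: "complex mat"
  assumes M: "M \<in> carrier_mat n k" and N: "N \<in> carrier_mat k m"
  shows "mat_adjoint (M * N) = mat_adjoint N * mat_adjoint M"
proof (rule eq_matI)
  fix i l
  assume "i < dim_row (mat_adjoint N * mat_adjoint M)" "l < dim_col (mat_adjoint N * mat_adjoint M)"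
  then have "i < m" "l < n"
    using M N by auto
  then show "mat_adjoint (M * N) $$ (i, l) = (mat_adjoint N * mat_adjoint M) $$ (i, l)"
    using M N by (auto simp: scalar_prod_def ac_simps intro!: sum.cong)
qed (use M N in auto)

text \<open>
  The entry \<open>(i, l)\<close> of the Gram matrix is the inner product of columns \<open>l\<close> and \<open>i\<close>, in this
  order, because \<open>\<bullet>c\<close> conjugates its second argument.
\<close>

lemma orthonormal_cols_adjoint_mult:
  assumes M: "M \<in> carrier_mat n k" and orth: "orthonormal_cols M"
  shows "mat_adjoint M * M = 1\<^sub>m k"
proof (rule eq_matI)
  fix i l
  assume "i < dim_row (1\<^sub>m k :: complex mat)" "l < dim_col (1\<^sub>m k :: complex mat)"
  then have il: "i < k" "l < k"
    by auto
  have "(mat_adjoint M * M) $$ (i, l) = col M l \<bullet>c col M i"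
    using M il by (auto simp: scalar_prod_def ac_simps intro!: sum.cong)
  also have "\<dots> = 1\<^sub>m k $$ (i, l)"
    using orth M il by (auto simp: orthonormal_cols_def)
  finally show "(mat_adjoint M * M) $$ (i, l) = 1\<^sub>m k $$ (i, l)" .
qed (use M in auto)

lemma first_cols_carrier:
  assumes "M \<in> carrier_mat n m" and "j \<le> m"
  shows "first_cols j M \<in> carrier_mat n j"
proof (rule carrier_matI)
  show "dim_row (first_cols j M) = n"
    using assms by (simp add: first_cols_def)
  show "dim_col (first_cols j M) = j"
    using assms by (simp add: first_cols_def)
qed

lemma orthonormal_first_cols:
  assumes M: "M \<in> carrier_mat n m" and "j \<le> m" and "orthonormal_cols M"
  shows "orthonormal_cols (first_cols j M)"
proof -
  have "col (first_cols j M) i = col M i" if "i < j" for i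
  proof -
    have "i < dim_col M" "col M i \<in> carrier_vec (dim_row M)"
      using M \<open>j \<le> m\<close> that by auto
    then show ?thesis
      using that unfolding first_cols_def by (subst col_mat_of_cols) auto
  qed
  moreover have "dim_col (first_cols j M) = j" "dim_col M = m"
    using first_cols_carrier[OF M \<open>j \<le> m\<close>] M by auto
  ultimately show ?thesis
    using assms(2,3) by (simp add: orthonormal_cols_def)
qed

text \<open>
  The inversion algorithm is specified only through success and failure: it succeeds because the
  identity is a unit, and its result is then a right inverse of the identity.
\<close>

lemma mat_inv_one [simp]: "mat_inv (1\<^sub>m k) = 1\<^sub>m k"
proof (cases "mat_inverse (1\<^sub>m k :: complex mat)")
  case None
  then have "1\<^sub>m k \<notin> Units (ring_mat TYPE(complex) k undefined)"
    by (rule mat_inverse(1)[OF one_carrier_mat])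
  then show ?thesis
    by (auto simp: Units_def ring_mat_def)
next
  case (Some N)
  then have "1\<^sub>m k * N = 1\<^sub>m k" "N \<in> carrier_mat k k"
    using mat_inverse(2)[OF one_carrier_mat] by blast+
  then show ?thesis
    by (simp add: mat_inv_def Some)
qed

section \<open>Reduction of the augmented system for Arnoldi bases\<close>

theorem theorem4p4:
  fixes n k j :: nat
    and A U C V H Vj Ut Vt B :: "complex mat"
    and r0 :: "complex vec"
    and \<U> \<V> \<U>t \<V>t :: "complex vec set"
  assumes A: "A \<in> carrier_mat n n"
    and r0: "r0 \<in> carrier_vec n"
    and arnoldi: "arnoldi n A r0 j V H"
    and Vj: "Vj = first_cols j V"
    and subspace: "complex_subspace n \<U>"
    and dim: "subspace_dim n \<U> = k"
    and basis: "basis_matrix n k U \<U>"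
    and C: "C = A * U"
    and orthonormal: "orthonormal_cols C"
    and \<V>: "\<V> = krylov n A r0 j"
    and \<V>t: "\<V>t = (*\<^sub>v) A ` \<V>"
    and \<U>t: "\<U>t = (*\<^sub>v) A ` \<U>"
    and Vt: "Vt = A * Vj"
    and Ut: "Ut = C"
    and B: "B = mat_inv (mat_adjoint Ut * A * U) * mat_adjoint Ut * A * Vj"
  shows "basis_matrix n j Vj \<V> \<and>
         basis_matrix n k Ut \<U>t \<and>
         vec_space.col_space n Vt = \<V>t \<and>
         (inj_on ((*\<^sub>v) A) \<V> \<longrightarrow> basis_matrix n j Vt \<V>t) \<and>
         invertible_mat (mat_adjoint Ut * A * U) \<and>
         aug_matrix A U Vj Ut Vt =
           mat_adjoint H * H
           - mat_adjoint H * mat_adjoint V * C * mat_adjoint C * V * H \<and>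
         aug_rhs A r0 U Ut Vt =
           (mat_adjoint H * mat_adjoint V * (1\<^sub>m n - C * mat_adjoint C)) *\<^sub>v r0 \<and>
         (\<forall>y \<in> carrier_vec j.
           aug_z A r0 U Vj Ut y = mat_adjoint C *\<^sub>v r0 - B *\<^sub>v y)"
proof -
  have V_carr: "V \<in> carrier_mat n (j + 1)" and V_orth: "orthonormal_cols V"
    and range: "vec_space.col_space n Vj = \<V>"
    and H: "H \<in> carrier_mat (j + 1) j" and AVj: "A * Vj = V * H"
    using arnoldi by (auto simp: arnoldi_def Vj \<V>)
  have U: "U \<in> carrier_mat n k" and \<U>: "\<U> = (*\<^sub>v) U ` carrier_vec k"
    using basis by (auto simp: basis_matrix_iff_inj_image)
  have Vj_carr: "Vj \<in> carrier_mat n j"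
    unfolding Vj by (rule first_cols_carrier[OF V_carr]) simp
  have C_carr: "C \<in> carrier_mat n k" and Vt_carr: "Vt \<in> carrier_mat n j"
    using A U Vj_carr by (auto simp: C Vt)
  note adj = mat_adjoint_carrier[OF C_carr] mat_adjoint_carrier[OF V_carr]
    mat_adjoint_carrier[OF H] mat_adjoint_carrier[OF Vj_carr]
  have CC: "mat_adjoint C * C = 1\<^sub>m k" and VV: "mat_adjoint V * V = 1\<^sub>m (j + 1)"
    using orthonormal_cols_adjoint_mult C_carr V_carr orthonormal V_orth by auto
  have VjVj: "mat_adjoint Vj * Vj = 1\<^sub>m j"
    using orthonormal_cols_adjoint_mult[OF Vj_carr]
      orthonormal_first_cols[OF V_carr _ V_orth, of j] by (simp add: Vj)
  have Gram: "mat_adjoint Ut * A * U = 1\<^sub>m k"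
    using CC assoc_mult_mat[OF adj(1) A U] by (simp add: Ut C[symmetric])
  have Phi: "aug_Phi A U Ut = C * mat_adjoint C"
    unfolding aug_Phi_def Gram using C_carr adj by (simp add: Ut C[symmetric])
  have Vt_adj: "mat_adjoint Vt = mat_adjoint H * mat_adjoint V"
    unfolding Vt AVj by (rule mat_adjoint_mult[OF V_carr H])

  have \<V>_image: "\<V> = (*\<^sub>v) Vj ` carrier_vec j"
    using vec_space.col_space_eq[OF Vj_carr] Vj_carr range by auto
  have comp: "(*\<^sub>v) (A * M) ` carrier_vec m = (*\<^sub>v) A ` (*\<^sub>v) M ` carrier_vec m"
    if "M \<in> carrier_mat n m" for M m
    unfolding image_image using A that by (intro image_cong) auto
  have inj_Vj: "inj_on ((*\<^sub>v) Vj) (carrier_vec j)"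
    by (rule inj_on_if_left_inverse[OF adj(4) Vj_carr VjVj])
  have basis_Vj: "basis_matrix n j Vj \<V>"
    using Vj_carr \<V>_image inj_Vj by (simp add: basis_matrix_iff_inj_image)
  have basis_Ut: "basis_matrix n k Ut \<U>t"
    using C_carr inj_on_if_left_inverse[OF adj(1) C_carr CC] comp[OF U]
    by (simp add: basis_matrix_iff_inj_image Ut \<U>t \<U> C)
  have \<V>t_image: "\<V>t = (*\<^sub>v) Vt ` carrier_vec j"
    using comp[OF Vj_carr] by (simp add: \<V>t \<V>_image Vt)
  have range_Vt: "vec_space.col_space n Vt = \<V>t"
    using vec_space.col_space_eq[OF Vt_carr] Vt_carr \<V>t_image by auto
  have basis_Vt: "basis_matrix n j Vt \<V>t" if "inj_on ((*\<^sub>v) A) \<V>"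
  proof -
    have "inj_on ((*\<^sub>v) A \<circ> (*\<^sub>v) Vj) (carrier_vec j)"
      using inj_Vj that unfolding \<V>_image by (rule comp_inj_on)
    then have "inj_on ((*\<^sub>v) Vt) (carrier_vec j)"
      by (rule inj_on_cong[THEN iffD1, rotated]) (use A Vj_carr in \<open>simp add: Vt\<close>)
    then show ?thesis
      using Vt_carr \<V>t_image by (simp add: basis_matrix_iff_inj_image)
  qed
  have invertible: "invertible_mat (mat_adjoint Ut * A * U)"
    unfolding Gram by (auto simp: invertible_mat_def inverts_mat_def intro!: exI[of _ "1\<^sub>m k"])

  \<comment> \<open>This is \<open>I - \<Phi>\<close>, the orthogonal projection onto the complement of the range of \<open>C\<close>.\<close>
  let ?P = "1\<^sub>m n - C * mat_adjoint C"
  have proj: "C * mat_adjoint C \<in> carrier_mat n n"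
    by (rule mult_carrier_mat[OF C_carr adj(1)])
  have P: "?P \<in> carrier_mat n n"
    by (rule minus_carrier_mat[OF proj])
  have matrix: "aug_matrix A U Vj Ut Vt =
      mat_adjoint H * H - mat_adjoint H * mat_adjoint V * C * mat_adjoint C * V * H"
  proof -
    let ?W = "mat_adjoint H * mat_adjoint V"
    have W: "?W \<in> carrier_mat j n"
      using adj by auto
    have VH: "V * H \<in> carrier_mat n j"
      using V_carr H by auto
    have "aug_matrix A U Vj Ut Vt = ?W * ?P * A * Vj"
      using A by (simp add: aug_matrix_def Phi Vt_adj)
    also have "\<dots> = ?W * ?P * (V * H)"
      using assoc_mult_mat[OF mult_carrier_mat[OF W P] A Vj_carr] by (simp only: AVj)
    also have "?W * ?P = ?W - ?W * (C * mat_adjoint C)"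
      using mult_minus_distrib_mat[OF W one_carrier_mat proj]
      by (simp only: right_mult_one_mat[OF W])
    also have "\<dots> * (V * H) = ?W * (V * H) - ?W * (C * mat_adjoint C) * (V * H)"
      by (rule minus_mult_distrib_mat[OF W mult_carrier_mat[OF W proj] VH])
    also have "?W * (V * H) = mat_adjoint H * (mat_adjoint V * V * H)"
      using assoc_mult_mat[OF adj(3,2) VH] assoc_mult_mat[OF adj(2) V_carr H] by simp
    also have "\<dots> = mat_adjoint H * H"
      using VV H by simp
    also have "?W * (C * mat_adjoint C) = ?W * C * mat_adjoint C"
      using assoc_mult_mat[OF W C_carr adj(1)] by simp
    also have "\<dots> * (V * H) = ?W * C * mat_adjoint C * V * H"
      using assoc_mult_mat[OF mult_carrier_mat[OF mult_carrier_mat[OF W C_carr] adj(1)] V_carr H]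
      by simp
    finally show ?thesis .
  qed
  have rhs: "aug_rhs A r0 U Ut Vt = (mat_adjoint H * mat_adjoint V * ?P) *\<^sub>v r0"
    using A by (simp add: aug_rhs_def Phi Vt_adj)
  have AVj_coeff: "mat_adjoint C * A * Vj \<in> carrier_mat k j"
    by (rule mult_carrier_mat[OF mult_carrier_mat[OF adj(1) A] Vj_carr])
  have B_eq: "B = mat_adjoint C * A * Vj"
    unfolding B Gram mat_inv_one unfolding Ut left_mult_one_mat[OF adj(1)] ..
  have z: "aug_z A r0 U Vj Ut y = mat_adjoint C *\<^sub>v r0 - B *\<^sub>v y" for y
    unfolding aug_z_def Gram mat_inv_one B_eq
    unfolding Ut left_mult_one_mat[OF adj(1)] left_mult_one_mat[OF AVj_coeff] ..
  show ?thesis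
    using basis_Vj basis_Ut range_Vt basis_Vt invertible matrix rhs z by blast
qed

end
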